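(* Let $T(x,y) := \sum_{n,k \geq 1} \frac{|\mathcal{T}_{n,k}|\, x^n y^k}{n!\, k!}$. Then $$T(x,y) = \log\left(\frac{1}{e^x + e^y - e^{x+y}}\right).$$
   Context: For $n,k \ge 1$, $\mathcal T_{n,k}$ is the set of non-plane (unordered) rooted trees with $n$ internal nodes (nodes with at least one child) labelled bijectively by the integers $0,\dots,n-1$ and $k$ leaves labelled bijectively by the integers $n,\dots,n+k-1$, which are increasing: every non-root node has a greater label than its parent. *)

theory Defs
  imports "HOL-Computational_Algebra.Formal_Power_Series"
begin

unbundle fps_syntax

text \<open>A rooted tree without an order on the children of a node is given by its node set, its
  root and its set of (parent, child) pairs.\<close>

definition rooted_tree :: "'a set \<Rightarrow> 'a \<Rightarrow> ('a \<times> 'a) set \<Rightarrow> bool" where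
  "rooted_tree V r E \<longleftrightarrow>
     finite V \<and> r \<in> V \<and> E \<subseteq> V \<times> V \<and>
     (\<forall>p. (p, r) \<notin> E) \<and>
     (\<forall>v \<in> V - {r}. \<exists>!p. (p, v) \<in> E) \<and>
     (\<forall>v \<in> V. (r, v) \<in> E\<^sup>*)"

definition internal_nodes :: "'a set \<Rightarrow> ('a \<times> 'a) set \<Rightarrow> 'a set" where
  "internal_nodes V E = {v \<in> V. \<exists>c. (v, c) \<in> E}"

definition leaves :: "'a set \<Rightarrow> ('a \<times> 'a) set \<Rightarrow> 'a set" where
  "leaves V E = {v \<in> V. \<not> (\<exists>c. (v, c) \<in> E)}"

text \<open>The nodes are identified with their labels, so a bijectively labelled tree is a tree on the
  set of labels. The edge set determines the root, which is its only node without a parent.\<close>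

definition increasing_trees :: "nat \<Rightarrow> nat \<Rightarrow> (nat \<times> nat) set set" where
  "increasing_trees n k =
     {E. (\<exists>r. rooted_tree {0..<n + k} r E) \<and>
         internal_nodes {0..<n + k} E = {0..<n} \<and>
         leaves {0..<n + k} E = {n..<n + k} \<and>
         (\<forall>(p, c) \<in> E. p < c)}"

text \<open>A bivariate formal power series in \<open>x\<close> and \<open>y\<close> is an element of \<^typ>\<open>real fps fps\<close>;
  the coefficient of \<open>x\<^sup>n y\<^sup>k\<close> in \<open>F\<close> is \<open>F $ n $ k\<close>.\<close>

definition var_x :: "real fps fps" where
  "var_x = fps_X"

definition var_y :: "real fps fps" where
  "var_y = fps_const fps_X"

text \<open>The substitution \<open>f(G) = (\<Sum>m. f\<^sub>m G\<^sup>m)\<close> of a bivariate series \<open>G\<close> with \<open>G $ 0 $ 0 = 0\<close>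
  (it is meaningful only for such \<open>G\<close>): all terms of \<open>G ^ m\<close> have total degree at least \<open>m\<close>,
  so only \<open>m \<le> n + k\<close> contribute to the coefficient of \<open>x\<^sup>n y\<^sup>k\<close>. The library's \<^const>\<open>fps_compose\<close>
  on \<^typ>\<open>real fps fps\<close> would require \<open>G $ 0 = 0\<close>, which fails for \<open>x + y\<close>.\<close>

definition bfps_subst :: "real fps \<Rightarrow> real fps fps \<Rightarrow> real fps fps" where
  "bfps_subst f G = Abs_fps (\<lambda>n. Abs_fps (\<lambda>k. \<Sum>m\<le>n + k. f $ m * (G ^ m) $ n $ k))"

definition bfps_exp :: "real fps fps \<Rightarrow> real fps fps" where
  "bfps_exp G = bfps_subst (fps_exp 1) G"

text \<open>Meaningful for \<open>F $ 0 $ 0 = 1\<close>; \<^term>\<open>fps_ln 1\<close> is the series of \<open>log (1 + z)\<close>.\<close>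

definition bfps_log :: "real fps fps \<Rightarrow> real fps fps" where
  "bfps_log F = bfps_subst (fps_ln 1) (F - 1)"

definition tree_series :: "real fps fps" where
  "tree_series = Abs_fps (\<lambda>n. Abs_fps (\<lambda>k.
     if n \<ge> 1 \<and> k \<ge> 1 then real (card (increasing_trees n k)) / (fact n * fact k) else 0))"

end

theory Submission imports Defs begin

text \<open>Deleting the children of the last internal node \<open>n\<close> of an increasing tree, which are all
  leaves, turns \<open>n\<close> into a leaf. Hence the series \<open>T\<close> satisfies
  \<open>T\<^sub>x = (e\<^sup>y - 1) (1 + T\<^sub>y)\<close> and \<open>T(0, y) = 0\<close>, which determines it. With
  \<open>F = e\<^sup>x + e\<^sup>y - e\<^sup>x\<^sup>+\<^sup>y = 1 - (e\<^sup>x - 1) (e\<^sup>y - 1)\<close> one has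
  \<open>F\<^sub>x = - e\<^sup>x (e\<^sup>y - 1)\<close> and \<open>F - F\<^sub>y = e\<^sup>x\<close>, so \<open>log (1 / F)\<close> solves the same equation.\<close>

section \<open>Counting increasing trees\<close>

text \<open>The leaf labels form an arbitrary set because deleting children leaves gaps in an
  interval. The first components of edges are the internal nodes, the second components all nodes
  except the root 0. Reachability need not be demanded: unique parents with smaller labels will
  imply it.\<close>

definition inc_trees_on :: "nat \<Rightarrow> nat set \<Rightarrow> (nat \<times> nat) set set" where
  "inc_trees_on n L = {E. fst ` E = {..<n} \<and> snd ` E = {1..<n} \<union> L \<and>
     single_valued (E\<inverse>) \<and> (\<forall>(p, c) \<in> E. p < c)}"

text \<open>The root is 0, since a parent of 0 would need a smaller label. Conversely, going from a
  node to its parent lowers the label, so every node is reached from 0 by strong induction.\<close>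

lemma increasing_trees_eq:
  assumes "n \<ge> 1"
  shows "increasing_trees n k = inc_trees_on n {n..<n + k}"
proof (intro set_eqI iffI)
  fix E assume "E \<in> increasing_trees n k"
  then obtain r where tr: "rooted_tree {0..<n + k} r E"
    and int: "internal_nodes {0..<n + k} E = {0..<n}"
    and inc: "\<forall>(p, c) \<in> E. p < c"
    by (auto simp: increasing_trees_def)
  have sub: "E \<subseteq> {0..<n + k} \<times> {0..<n + k}"
    and par: "\<And>v. v < n + k \<Longrightarrow> v \<noteq> r \<Longrightarrow> \<exists>!p. (p, v) \<in> E"
    and rt: "\<And>p. (p, r) \<notin> E"
    using tr by (auto simp: rooted_tree_def)
  have r: "r = 0"
    using par[of 0] inc assms by fastforce
  have "fst ` E = {..<n}"
  proof -
    have "fst ` E = internal_nodes {0..<n + k} E"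
      using sub unfolding internal_nodes_def by force
    then show ?thesis using int by auto
  qed
  moreover have "snd ` E = {1..<n} \<union> {n..<n + k}"
  proof -
    have "snd ` E \<subseteq> {1..<n + k}"
      using sub rt r by (force simp: Suc_le_eq intro: gr0I)
    moreover have "{1..<n + k} \<subseteq> snd ` E"
    proof
      fix v assume "v \<in> {1..<n + k}"
      then obtain p where "(p, v) \<in> E" using par[of v] r by auto
      then show "v \<in> snd ` E" by force
    qed
    ultimately show ?thesis using assms by auto
  qed
  moreover have "single_valued (E\<inverse>)"
  proof (rule single_valuedI)
    fix v p q assume "(v, p) \<in> E\<inverse>" "(v, q) \<in> E\<inverse>"
    moreover from this have "v < n + k" "v \<noteq> r" using sub rt by auto
    ultimately show "p = q" using par[of v] by auto
  qed
  ultimately show "E \<in> inc_trees_on n {n..<n + k}"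
    using inc by (simp add: inc_trees_on_def)
next
  fix E assume "E \<in> inc_trees_on n {n..<n + k}"
  then have f: "fst ` E = {..<n}" and s: "snd ` E = {1..<n} \<union> {n..<n + k}"
    and sv: "single_valued (E\<inverse>)" and inc: "\<forall>(p, c) \<in> E. p < c"
    by (auto simp: inc_trees_on_def)
  have s': "snd ` E = {1..<n + k}" using s assms by auto
  have mem: "p < n \<and> 1 \<le> c \<and> c < n + k \<and> p < c" if "(p, c) \<in> E" for p c
  proof -
    have "p \<in> fst ` E" "c \<in> snd ` E" using that by force+
    then show ?thesis using f s' inc that by auto
  qed
  have par: "\<exists>p. (p, v) \<in> E" if "v \<noteq> 0" "v < n + k" for v
  proof -
    have "v \<in> snd ` E" using s' that by simp
    then show ?thesis by force
  qed
  have chd: "\<exists>c. (v, c) \<in> E" if "v < n" for v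
  proof -
    have "v \<in> fst ` E" using f that by simp
    then show ?thesis by force
  qed
  have reach: "(0, v) \<in> E\<^sup>*" if "v < n + k" for v
    using that
  proof (induction v rule: less_induct)
    case (less v)
    show ?case
    proof (cases "v = 0")
      case False
      then obtain p where p: "(p, v) \<in> E" using par less.prems by blast
      then have "(0, p) \<in> E\<^sup>*" using less mem[OF p] by auto
      then show ?thesis using p by (rule rtrancl_into_rtrancl)
    qed simp
  qed
  have "rooted_tree {0..<n + k} 0 E"
    unfolding rooted_tree_def
  proof (intro conjI ballI)
    show "E \<subseteq> {0..<n + k} \<times> {0..<n + k}" using mem by fastforce
    show "\<forall>p. (p, 0) \<notin> E" using mem by fastforce
    show "\<exists>!p. (p, v) \<in> E" if "v \<in> {0..<n + k} - {0}" for v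
    proof -
      have "\<exists>p. (p, v) \<in> E" using par that by auto
      then show ?thesis using sv by (auto dest: single_valuedD)
    qed
  qed (use reach assms in auto)
  moreover have "internal_nodes {0..<n + k} E = {0..<n}"
    using chd mem by (fastforce simp: internal_nodes_def)
  moreover have "leaves {0..<n + k} E = {n..<n + k}"
  proof (intro set_eqI iffI)
    fix v assume "v \<in> leaves {0..<n + k} E"
    then show "v \<in> {n..<n + k}" using chd[of v] by (fastforce simp: leaves_def)
  next
    fix v assume "v \<in> {n..<n + k}"
    then show "v \<in> leaves {0..<n + k} E" using mem[of v] by (fastforce simp: leaves_def)
  qed
  ultimately show "E \<in> increasing_trees n k"
    using inc by (auto simp: increasing_trees_def)
qed

lemma finite_inc_trees_on:
  assumes "finite L"
  shows "finite (inc_trees_on n L)"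
proof (rule finite_subset)
  show "inc_trees_on n L \<subseteq> Pow ({..<n} \<times> ({1..<n} \<union> L))"
  proof
    fix E assume "E \<in> inc_trees_on n L"
    then have "fst ` E \<times> snd ` E = {..<n} \<times> ({1..<n} \<union> L)"
      by (simp add: inc_trees_on_def)
    then show "E \<in> Pow ({..<n} \<times> ({1..<n} \<union> L))"
      using subset_fst_snd[of E] by simp
  qed
qed (use assms in simp)

lemma inc_trees_on_1:
  assumes "0 \<notin> L"
  shows "inc_trees_on 1 L = (if L = {} then {} else {{0} \<times> L})"
proof (intro set_eqI iffI)
  fix E assume "E \<in> inc_trees_on 1 L"
  then have f: "fst ` E = {0}" and s: "snd ` E = L"
    by (auto simp: inc_trees_on_def)
  have mem: "p = 0 \<and> c \<in> L" if "(p, c) \<in> E" for p c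
    using that f s by (metis fst_conv image_eqI singletonD snd_conv)
  moreover have "(0, c) \<in> E" if "c \<in> L" for c
  proof -
    have "c \<in> snd ` E" using that s by simp
    then show ?thesis using mem by force
  qed
  ultimately have "E = {0} \<times> L" by auto
  moreover have "L \<noteq> {}" using f s by auto
  ultimately show "E \<in> (if L = {} then {} else {{0} \<times> L})" by simp
next
  fix E :: "(nat \<times> nat) set"
  assume "E \<in> (if L = {} then {} else {{0} \<times> L})"
  then have "E = {0} \<times> L" "L \<noteq> {}" by (auto split: if_splits)
  moreover have "0 < c" if "c \<in> L" for c
    using that assms by (cases c) auto
  ultimately show "E \<in> inc_trees_on 1 L"
    by (auto simp: inc_trees_on_def single_valued_def)
qed

text \<open>As \<open>n\<close> is the largest internal label, its children \<open>A\<close> are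
  leaves, and there is at least one. Cutting them off makes \<open>n\<close> a leaf and leaves the
  leaf set \<open>insert n (L - A)\<close>; attaching \<open>A\<close> to \<open>n\<close> again is
  the inverse.\<close>

lemma bij_betw_inc_trees_on_Suc:
  assumes n: "n \<ge> 1" and L: "L \<inter> {..n} = {}"
  shows "bij_betw (\<lambda>(A, E). E \<union> {n} \<times> A)
    (SIGMA A : Pow L - {{}}. inc_trees_on n (insert n (L - A))) (inc_trees_on (Suc n) L)"
proof (rule bij_betw_byWitness[where f' = "\<lambda>E. (E `` {n}, E - {n} \<times> UNIV)"])
  let ?S = "SIGMA A : Pow L - {{}}. inc_trees_on n (insert n (L - A))"
  \<comment> \<open>In the smaller tree \<open>n\<close> is a leaf, so the edges starting at
    \<open>n\<close> in the union are exactly the added ones and both components can be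
    recovered.\<close>
  have fst_lt: "p < n" if "E \<in> inc_trees_on n M" "(p, c) \<in> E" for E M p c
  proof -
    have "p \<in> fst ` E" using that(2) by force
    then show ?thesis using that(1) by (auto simp: inc_trees_on_def)
  qed
  show "\<forall>a \<in> ?S. (\<lambda>E. (E `` {n}, E - {n} \<times> UNIV)) ((\<lambda>(A, E). E \<union> {n} \<times> A) a) = a"
    using fst_lt by fastforce
  show "\<forall>E \<in> inc_trees_on (Suc n) L. (\<lambda>(A, E). E \<union> {n} \<times> A) (E `` {n}, E - {n} \<times> UNIV) = E"
    by auto
  show "(\<lambda>(A, E). E \<union> {n} \<times> A) ` ?S \<subseteq> inc_trees_on (Suc n) L"
  proof
    fix z assume "z \<in> (\<lambda>(A, E). E \<union> {n} \<times> A) ` ?S"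
    then obtain A E where A: "A \<subseteq> L" "A \<noteq> {}" and z: "z = E \<union> {n} \<times> A"
      and E: "E \<in> inc_trees_on n (insert n (L - A))"
      by auto
    have f: "fst ` E = {..<n}" and s: "snd ` E = {1..<n} \<union> insert n (L - A)"
      and sv: "single_valued (E\<inverse>)" and inc: "\<forall>(p, c) \<in> E. p < c"
      using E by (auto simp: inc_trees_on_def)
    have AL: "n < c" if "c \<in> A" for c
      using that A L by (meson disjoint_iff atMost_iff not_le subsetD)
    \<comment> \<open>The nodes of \<open>A\<close> have no parent in \<open>E\<close>, so attaching
      them to \<open>n\<close> keeps parents unique.\<close>
    have notA: "c \<notin> A" if "(p, c) \<in> E" for p c
    proof -
      have "c \<in> snd ` E" using that by force
      then show ?thesis using s AL by (auto dest: AL)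
    qed
    have "fst ` (E \<union> {n} \<times> A) = {..<Suc n}"
      using f A by (auto simp: image_Un)
    moreover have "snd ` (E \<union> {n} \<times> A) = {1..<Suc n} \<union> L"
      using s A n by (auto simp: image_Un)
    moreover have "single_valued ((E \<union> {n} \<times> A)\<inverse>)"
      using sv notA by (auto simp: single_valued_def)
    ultimately show "z \<in> inc_trees_on (Suc n) L"
      unfolding z using inc AL by (auto simp: inc_trees_on_def)
  qed
  show "(\<lambda>E. (E `` {n}, E - {n} \<times> UNIV)) ` inc_trees_on (Suc n) L \<subseteq> ?S"
  proof
    fix z assume "z \<in> (\<lambda>E. (E `` {n}, E - {n} \<times> UNIV)) ` inc_trees_on (Suc n) L"
    then obtain E where z: "z = (E `` {n}, E - {n} \<times> UNIV)" and E: "E \<in> inc_trees_on (Suc n) L"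
      by blast
    have f: "fst ` E = {..<Suc n}" and s: "snd ` E = {1..<Suc n} \<union> L"
      and sv: "single_valued (E\<inverse>)" and inc: "\<And>p c. (p, c) \<in> E \<Longrightarrow> p < c"
      using E by (auto simp: inc_trees_on_def)
    have mem: "p \<le> n \<and> (c \<in> {1..n} \<or> c \<in> L)" if "(p, c) \<in> E" for p c
    proof -
      have "p \<in> fst ` E" "c \<in> snd ` E" using that by force+
      then show ?thesis using f s by auto
    qed
    have dom: "\<exists>c. (p, c) \<in> E" if "p \<le> n" for p
    proof -
      have "p \<in> fst ` E" using f that by auto
      then show ?thesis by force
    qed
    have ran: "\<exists>p. (p, c) \<in> E" if "c \<in> {1..n} \<or> c \<in> L" for c
    proof -
      have "c \<in> snd ` E" using s that by auto
      then show ?thesis by force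
    qed
    have un: "p = q" if "(p, c) \<in> E" "(q, c) \<in> E" for p q c
      using sv that by (auto dest: single_valuedD)
    have "E `` {n} \<subseteq> L" using mem inc by fastforce
    moreover have "E `` {n} \<noteq> {}" using dom[of n] by auto
    moreover have "E - {n} \<times> UNIV \<in> inc_trees_on n (insert n (L - E `` {n}))"
    proof -
      have "fst ` (E - {n} \<times> UNIV) = {..<n}"
      proof (intro set_eqI iffI)
        fix p assume "p \<in> fst ` (E - {n} \<times> UNIV)"
        then show "p \<in> {..<n}" using mem by fastforce
      next
        fix p assume p: "p \<in> {..<n}"
        then obtain c where "(p, c) \<in> E" using dom[of p] by auto
        then show "p \<in> fst ` (E - {n} \<times> UNIV)" using p by force
      qed
      moreover have "snd ` (E - {n} \<times> UNIV) = {1..<n} \<union> insert n (L - E `` {n})"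
      proof (intro set_eqI iffI)
        fix c assume "c \<in> snd ` (E - {n} \<times> UNIV)"
        then have "\<exists>p. (p, c) \<in> E \<and> p \<noteq> n" by fastforce
        then obtain p where p: "(p, c) \<in> E" "p \<noteq> n" by blast
        then have "c \<notin> E `` {n}" using un by auto
        then show "c \<in> {1..<n} \<union> insert n (L - E `` {n})" using mem[OF p(1)] by auto
      next
        fix c assume c: "c \<in> {1..<n} \<union> insert n (L - E `` {n})"
        then obtain p where p: "(p, c) \<in> E" using ran[of c] n by auto
        \<comment> \<open>If \<open>c\<close> is at most \<open>n\<close>, a parent \<open>n\<close>
          would violate the increasing labels; otherwise \<open>c\<close> was chosen outside the
          children of \<open>n\<close>.\<close>
        have "p \<noteq> n" using p c inc[OF p] by auto
        then show "c \<in> snd ` (E - {n} \<times> UNIV)" using p by force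
      qed
      moreover have "single_valued ((E - {n} \<times> UNIV)\<inverse>)"
        using un by (auto simp: single_valued_def)
      ultimately show ?thesis using inc by (auto simp: inc_trees_on_def)
    qed
    ultimately show "z \<in> ?S" using z by auto
  qed
qed

section \<open>Exponential generating functions in the leaves\<close>

lemma sum_Pow_card:
  fixes f :: "nat \<Rightarrow> 'a::comm_semiring_1"
  assumes "finite S"
  shows "(\<Sum>A\<in>Pow S. f (card A)) = (\<Sum>i\<le>card S. of_nat (card S choose i) * f i)"
proof -
  have "(\<Sum>A\<in>Pow S. f (card A)) = (\<Sum>i\<le>card S. \<Sum>A\<in>{A \<in> Pow S. card A = i}. f (card A))"
    by (rule sum.group[symmetric]) (use assms card_mono in auto)
  also have "\<dots> = (\<Sum>i\<le>card S. of_nat (card S choose i) * f i)"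
    using assms by (intro sum.cong) (auto simp: n_subsets)
  finally show ?thesis .
qed

text \<open>The deletion on exponential generating functions in \<open>y\<close>: the derivative
  marks the leaf that becomes internal, and the factor \<open>fps_exp 1 - 1\<close> chooses its
  nonempty set of children.\<close>

definition exp_step :: "real fps \<Rightarrow> real fps" where
  "exp_step f = (fps_exp 1 - 1) * fps_deriv f"

text \<open>Induction along the deletion bijection, for all \<open>L\<close> at once because the
  leaf set changes. A single internal node gives \<open>fps_exp 1 - 1\<close>, so
  \<open>Suc n\<close> internal nodes take \<open>n\<close> iterations.\<close>

lemma card_inc_trees_on:
  assumes "finite L" and "L \<inter> {..n} = {}"
  shows "real (card (inc_trees_on (Suc n) L)) =
    fact (card L) * ((exp_step ^^ n) (fps_exp 1 - 1)) $ card L"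
  using assms
proof (induction n arbitrary: L)
  case 0
  then have "inc_trees_on (Suc 0) L = (if L = {} then {} else {{0} \<times> L})"
    using inc_trees_on_1[of L] by auto
  with 0 show ?case by auto
next
  case (Suc n)
  define a where "a = (exp_step ^^ n) (fps_exp 1 - 1)"
  define k where "k = card L"
  \<comment> \<open>The number of smaller trees for one set \<open>A\<close> of size
    \<open>i\<close>: they have the \<open>k - i\<close> remaining leaves and the new leaf
    \<open>Suc n\<close>. The value 0 at \<open>i = 0\<close> lets the sum run over all subsets of
    \<open>L\<close>.\<close>
  define g where "g i = (if i = 0 then 0 else fact (Suc (k - i)) * a $ Suc (k - i))" for i
  have "card (inc_trees_on (Suc (Suc n)) L) =
      card (SIGMA A : Pow L - {{}}. inc_trees_on (Suc n) (insert (Suc n) (L - A)))"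
    using bij_betw_same_card[OF bij_betw_inc_trees_on_Suc[of "Suc n" L]] Suc.prems by simp
  also have "\<dots> = (\<Sum>A\<in>Pow L - {{}}. card (inc_trees_on (Suc n) (insert (Suc n) (L - A))))"
    using Suc.prems by (subst card_SigmaI) (auto intro: finite_inc_trees_on)
  finally have "real (card (inc_trees_on (Suc (Suc n)) L)) =
      (\<Sum>A\<in>Pow L - {{}}. real (card (inc_trees_on (Suc n) (insert (Suc n) (L - A)))))"
    by simp
  also have "\<dots> = (\<Sum>A\<in>Pow L - {{}}. g (card A))"
  proof (rule sum.cong)
    fix A assume A: "A \<in> Pow L - {{}}"
    have fin: "finite A" using A Suc.prems by (auto intro: finite_subset)
    have c: "card (insert (Suc n) (L - A)) = Suc (k - card A)"
      using A Suc.prems fin by (subst card_insert_disjoint) (auto simp: card_Diff_subset k_def)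
    have "real (card (inc_trees_on (Suc n) (insert (Suc n) (L - A)))) =
        fact (Suc (k - card A)) * a $ Suc (k - card A)"
      unfolding a_def c[symmetric] using Suc.prems by (intro Suc.IH) auto
    then show "real (card (inc_trees_on (Suc n) (insert (Suc n) (L - A)))) = g (card A)"
      using A fin by (simp add: g_def)
  qed simp
  also have "\<dots> = (\<Sum>A\<in>Pow L. g (card A))"
    using Suc.prems by (intro sum.mono_neutral_left) (auto simp: g_def)
  also have "\<dots> = (\<Sum>i\<le>k. real (k choose i) * g i)"
    using sum_Pow_card[OF Suc.prems(1), of g] by (simp add: k_def)
  \<comment> \<open>The binomial splits the factorials into a Cauchy product; \<open>g 0 = 0\<close>
    matches the vanishing constant term of \<open>fps_exp 1 - 1\<close>.\<close>
  also have "\<dots> = (\<Sum>i\<le>k. fact k * ((fps_exp 1 - 1) $ i * fps_deriv a $ (k - i)))"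
  proof (rule sum.cong)
    fix i assume "i \<in> {..k}"
    then show "real (k choose i) * g i = fact k * ((fps_exp 1 - 1) $ i * fps_deriv a $ (k - i))"
      by (simp add: g_def binomial_fact field_simps)
  qed simp
  also have "\<dots> = fact k * exp_step a $ k"
    by (simp add: exp_step_def fps_mult_nth sum_distrib_left atMost_atLeast0)
  finally show ?case by (simp add: a_def k_def)
qed

lemma tree_series_nth_Suc:
  "tree_series $ Suc n = fps_const (1 / fact (Suc n)) * (exp_step ^^ n) (fps_exp 1 - 1)"
proof (rule fps_ext)
  fix k
  define a where "a = (exp_step ^^ n) (fps_exp 1 - 1)"
  \<comment> \<open>\<open>tree_series\<close> is set to 0 at \<open>k = 0\<close>, so that
    coefficient must vanish here as well; it does, through the factor
    \<open>fps_exp 1 - 1\<close>.\<close>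
  have a0: "a $ 0 = 0" by (cases n) (simp_all add: a_def exp_step_def)
  have "{Suc n..<Suc n + k} \<inter> {..n} = {}" by auto
  then have "real (card (increasing_trees (Suc n) k)) = fact k * a $ k"
    using increasing_trees_eq[of "Suc n" k] card_inc_trees_on[of "{Suc n..<Suc n + k}" n]
    by (simp add: a_def)
  then have "tree_series $ Suc n $ k = a $ k / fact (Suc n)"
    using a0 by (cases "k = 0") (simp_all add: tree_series_def del: fact_Suc)
  then show "tree_series $ Suc n $ k =
      (fps_const (1 / fact (Suc n)) * (exp_step ^^ n) (fps_exp 1 - 1)) $ k"
    unfolding a_def[symmetric] by (simp del: fact_Suc)
qed

section \<open>Bivariate power series\<close>

text \<open>The outer variable is \<open>x\<close>, so \<open>fps_deriv\<close> is the partial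
  derivative in \<open>x\<close>, and the one in \<open>y\<close> acts on each coefficient.\<close>

definition deriv_y :: "real fps fps \<Rightarrow> real fps fps" where
  "deriv_y F = Abs_fps (\<lambda>n. fps_deriv (F $ n))"

lemma deriv_y_nth [simp]: "deriv_y F $ n = fps_deriv (F $ n)"
  by (simp add: deriv_y_def)

lemma deriv_y_simps [simp]:
  "deriv_y (F + G) = deriv_y F + deriv_y G"
  "deriv_y (F - G) = deriv_y F - deriv_y G"
  "deriv_y 1 = 0"
  by (auto simp: fps_eq_iff)

lemma deriv_y_mult: "deriv_y (F * G) = deriv_y F * G + F * deriv_y G"
  by (rule fps_ext) (simp add: fps_mult_nth sum.distrib fps_deriv_sum add.commute)

lemma deriv_y_const [simp]: "deriv_y (fps_const c) = fps_const (fps_deriv c)"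
  by (rule fps_ext) simp

lemma fps_deriv_deriv_y: "fps_deriv (deriv_y F) = deriv_y (fps_deriv F)"
proof (rule fps_ext)
  fix n
  show "fps_deriv (deriv_y F) $ n = deriv_y (fps_deriv F) $ n"
    using fps_deriv_mult_const_left[of "of_nat (n + 1)" "F $ (n + 1)"]
    by (simp only: fps_deriv_nth deriv_y_nth fps_of_nat)
qed

text \<open>Comparing coefficients of powers of \<open>x\<close> gives a recursion:
  \<open>F $ 0 = 0\<close> yields \<open>F $ 1 = fps_exp 1 - 1\<close>, and from then on the
  constant 1 drops out and \<open>(n + 2) * F $ (n + 2)\<close> is
  \<open>exp_step (F $ (n + 1))\<close>. The result is the formula found for
  \<open>tree_series\<close>.\<close>

lemma pde_unique:
  assumes "F $ 0 = 0" and pde: "fps_deriv F = fps_const (fps_exp 1 - 1) * (1 + deriv_y F)"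
  shows "F $ Suc n = fps_const (1 / fact (Suc n)) * (exp_step ^^ n) (fps_exp 1 - 1)"
proof (induction n)
  case 0
  have "fps_deriv F $ 0 = (fps_exp 1 - 1) * (1 + deriv_y F) $ 0"
    unfolding pde by (rule fps_mult_left_const_nth)
  then show ?case using assms(1) by simp
next
  case (Suc n)
  have "fps_deriv F $ Suc n = (fps_exp 1 - 1) * (1 + deriv_y F) $ Suc n"
    unfolding pde by (rule fps_mult_left_const_nth)
  then have "of_nat (Suc (Suc n)) * F $ Suc (Suc n) = exp_step (F $ Suc n)"
    by (simp add: exp_step_def)
  also have "\<dots> = fps_const (1 / fact (Suc n)) * (exp_step ^^ Suc n) (fps_exp 1 - 1)"
    unfolding Suc.IH by (simp add: exp_step_def mult_ac)
  finally have *: "fps_const (real (Suc (Suc n))) * F $ Suc (Suc n) =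
      fps_const (1 / fact (Suc n)) * (exp_step ^^ Suc n) (fps_exp 1 - 1)"
    by (simp only: fps_of_nat)
  have "F $ Suc (Suc n) = fps_const (1 / real (Suc (Suc n))) *
      (fps_const (real (Suc (Suc n))) * F $ Suc (Suc n))"
    by (simp flip: mult.assoc)
  then show ?case
    unfolding * by (simp flip: mult.assoc)
qed

section \<open>The exponential series\<close>

definition exp_x :: "real fps fps" where
  "exp_x = Abs_fps (\<lambda>n. fps_const (1 / fact n))"

lemma bfps_exp_var_x: "bfps_exp var_x = exp_x"
proof (intro fps_ext)
  fix n k
  have "bfps_exp var_x $ n $ k = (\<Sum>m\<le>n + k. if m = n then if k = 0 then 1 / fact n else 0 else 0)"
    unfolding bfps_exp_def bfps_subst_def var_x_def fps_nth_Abs_fps by (rule sum.cong) auto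
  then show "bfps_exp var_x $ n $ k = exp_x $ n $ k"
    by (simp add: exp_x_def)
qed

lemma bfps_exp_var_y: "bfps_exp var_y = fps_const (fps_exp 1)"
proof (intro fps_ext)
  fix n k
  have "bfps_exp var_y $ n $ k = (\<Sum>m\<le>n + k. if m = k then if n = 0 then 1 / fact k else 0 else 0)"
    unfolding bfps_exp_def bfps_subst_def var_y_def fps_nth_Abs_fps by (rule sum.cong) auto
  then show "bfps_exp var_y $ n $ k = fps_const (fps_exp 1) $ n $ k"
    by simp
qed

text \<open>By the binomial theorem the power is homogeneous of degree \<open>m\<close>. In the
  exponential only \<open>m = n + k\<close> will therefore contribute, the very last term of the
  truncated sum.\<close>

lemma var_x_plus_var_y_power_nth:
  "((var_x + var_y) ^ m) $ n $ k = (if m = n + k then real (m choose n) else 0)"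
proof -
  have "((var_x + var_y) ^ m) $ n $ k =
      (\<Sum>i\<le>m. (of_nat (m choose i) * fps_X ^ i * fps_const (fps_X ^ (m - i)) :: real fps fps) $ n $ k)"
    by (simp add: binomial_ring var_x_def var_y_def fps_sum_nth)
  also have "\<dots> = (\<Sum>i\<le>m. if i = n then if m - n = k then real (m choose n) else 0 else 0)"
    by (rule sum.cong) (auto simp flip: fps_of_nat)
  also have "\<dots> = (if m = n + k then real (m choose n) else 0)"
    by auto
  finally show ?thesis .
qed

lemma bfps_exp_add: "bfps_exp (var_x + var_y) = exp_x * fps_const (fps_exp 1)"
proof (intro fps_ext)
  fix n k
  have "bfps_exp (var_x + var_y) $ n $ k =
      (\<Sum>m\<le>n + k. if m = n + k then real ((n + k) choose n) / fact (n + k) else 0)"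
    unfolding bfps_exp_def bfps_subst_def fps_nth_Abs_fps
    by (rule sum.cong) (auto simp: var_x_plus_var_y_power_nth)
  also have "\<dots> = 1 / (fact n * fact k)"
    by (simp add: binomial_fact)
  finally show "bfps_exp (var_x + var_y) $ n $ k = (exp_x * fps_const (fps_exp 1)) $ n $ k"
    by (simp add: exp_x_def)
qed

lemma exp_x_nth_0 [simp]: "exp_x $ 0 = 1"
  by (simp add: exp_x_def)

lemma fps_deriv_exp_x [simp]: "fps_deriv exp_x = exp_x"
proof (rule fps_ext)
  fix n
  have "fps_const (real (Suc n)) * fps_const (1 / fact (Suc n)) = fps_const (1 / fact n)"
    by (simp del: of_nat_Suc)
  then show "fps_deriv exp_x $ n = exp_x $ n"
    by (simp add: exp_x_def fps_of_nat del: fps_const_mult of_nat_Suc)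
qed

lemma deriv_y_exp_x [simp]: "deriv_y exp_x = 0"
  by (rule fps_ext) (simp add: exp_x_def)

section \<open>The logarithm\<close>

text \<open>\<open>G ^ m\<close> is divisible by the \<open>m\<close>-th power of \<open>x\<close>,
  so the terms with \<open>m > n\<close> vanish and both truncations agree. This makes the chain
  rule for \<open>fps_compose\<close> available.\<close>

lemma bfps_subst_eq_compose:
  assumes "G $ 0 = 0"
  shows "bfps_subst f G = Abs_fps (\<lambda>m. fps_const (f $ m)) oo G"
proof (intro fps_ext)
  fix n k
  have "(\<Sum>m\<le>n + k. f $ m * (G ^ m) $ n $ k) = (\<Sum>m=0..n. f $ m * (G ^ m) $ n $ k)"
    using startsby_zero_power_prefix[OF assms] by (intro sum.mono_neutral_right) auto
  then show "bfps_subst f G $ n $ k = (Abs_fps (\<lambda>m. fps_const (f $ m)) oo G) $ n $ k"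
    by (simp add: bfps_subst_def fps_compose_nth fps_sum_nth)
qed

lemma bfps_log_nth_0:
  assumes "H $ 0 = 1"
  shows "bfps_log H $ 0 = 0"
  using assms by (simp add: bfps_log_def bfps_subst_eq_compose)

text \<open>With \<open>l\<close> the series of log(1 + z), substituting \<open>H - 1\<close> into
  \<open>(1 + z) * l' = 1\<close> shows that \<open>l'\<close> becomes the reciprocal
  \<open>F\<close> of \<open>H\<close>; the chain rule does the rest.\<close>

lemma fps_deriv_bfps_log:
  assumes FH: "F * H = 1" and H0: "H $ 0 = 1"
  shows "fps_deriv (bfps_log H) = F * fps_deriv H"
proof -
  define l :: "real fps fps" where "l = Abs_fps (\<lambda>m. fps_const (fps_ln 1 $ m))"
  have G0: "(H - 1) $ 0 = 0" using H0 by simp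
  have "fps_deriv l = Abs_fps (\<lambda>m. fps_const ((- 1) ^ m))"
  proof (rule fps_ext)
    fix m
    have "fps_const (real (Suc m)) * fps_const (fps_ln 1 $ Suc m) = fps_const ((- 1) ^ m)"
      by (simp add: fps_ln_nth del: of_nat_Suc)
    then show "fps_deriv l $ m = Abs_fps (\<lambda>m. fps_const ((- 1) ^ m)) $ m"
      by (simp add: l_def fps_of_nat del: fps_const_mult of_nat_Suc)
  qed
  then have "(1 + fps_X) * fps_deriv l = 1"
    by (intro fps_ext) (auto simp: distrib_right gr0_conv_Suc simp flip: fps_const_neg)
  then have "((1 + fps_X) oo (H - 1)) * (fps_deriv l oo (H - 1)) = 1"
    using G0 by (simp flip: fps_compose_mult_distrib)
  then have "F * (H * (fps_deriv l oo (H - 1))) = F"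
    using G0 by (simp add: fps_compose_add_distrib)
  then have "fps_deriv l oo (H - 1) = F"
    using FH by (simp flip: mult.assoc)
  moreover have "fps_deriv (bfps_log H) = (fps_deriv l oo (H - 1)) * fps_deriv H"
    using G0 fps_compose_deriv[OF G0, of l] by (simp add: bfps_log_def bfps_subst_eq_compose l_def)
  ultimately show ?thesis
    by simp
qed

text \<open>Both sides vanish at \<open>x = 0\<close>, and their \<open>x\<close>-derivatives agree because the mixed partial
  derivatives of \<open>H\<close> and of \<open>log H\<close> commute.\<close>

lemma deriv_y_bfps_log:
  assumes FH: "F * H = 1" and H0: "H $ 0 = 1"
  shows "deriv_y (bfps_log H) = F * deriv_y H"
proof -
  note Lx = fps_deriv_bfps_log[OF FH H0]
  have Fx: "fps_deriv F = - (F * F * fps_deriv H)"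
  proof -
    have "fps_deriv (F * H) * F = 0" using FH by simp
    then have "fps_deriv F * (F * H) + F * F * fps_deriv H = 0" by (simp add: algebra_simps)
    then show ?thesis unfolding FH by (simp add: eq_neg_iff_add_eq_0)
  qed
  have Fy: "deriv_y F = - (F * F * deriv_y H)"
  proof -
    have "deriv_y (F * H) * F = 0" using FH by simp
    then have "deriv_y F * (F * H) + F * F * deriv_y H = 0"
      by (simp add: algebra_simps deriv_y_mult)
    then show ?thesis unfolding FH by (simp add: eq_neg_iff_add_eq_0)
  qed
  \<comment> \<open>Both sides expand to \<open>F\<close> times the mixed derivative of
    \<open>H\<close>, minus \<open>F * F\<close> times the product of its two first
    derivatives.\<close>
  have "fps_deriv (deriv_y (bfps_log H)) = fps_deriv (F * deriv_y H)"
    unfolding fps_deriv_deriv_y Lx deriv_y_mult fps_deriv_mult Fx Fy by (simp add: mult_ac)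
  moreover have "deriv_y (bfps_log H) $ 0 = (F * deriv_y H) $ 0"
    using H0 bfps_log_nth_0[OF H0] by simp
  ultimately show ?thesis
    unfolding fps_deriv_eq_iff by simp
qed

section \<open>The differential equation for the logarithm\<close>

theorem theorem6p1:
  "tree_series = bfps_log (inverse (bfps_exp var_x + bfps_exp var_y - bfps_exp (var_x + var_y)))"
proof -
  define e where "e = fps_const (fps_exp (1::real))"
  define F where "F = exp_x + e - exp_x * e"
  define H where "H = inverse F"
  have F0: "F $ 0 = 1" by (simp add: F_def e_def)
  then have H0: "H $ 0 = 1" by (simp add: H_def)
  have FH: "F * H = 1"
    \<comment> \<open>The coefficient ring \<open>real fps\<close> is not a field; invertibility
      rests on the leading coefficient \<open>F $ 0\<close> being 1.\<close>
    unfolding H_def fps_inverse_def[of F] by (rule fps_right_inverse) (use F0 in simp)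
  note Lx = fps_deriv_bfps_log[OF FH H0]
  have Fx: "fps_deriv F = exp_x * (1 - e)"
    by (simp add: F_def e_def algebra_simps)
  have Fy: "deriv_y F = e * (1 - exp_x)"
    by (simp add: F_def e_def algebra_simps deriv_y_mult)
  have Hx: "F * fps_deriv H = exp_x * (e - 1) * H"
  proof -
    have "fps_deriv (F * H) = 0" using FH by simp
    then show ?thesis by (simp add: Fx algebra_simps)
  qed
  have Hy: "F * deriv_y H = e * (exp_x - 1) * H"
  proof -
    have "deriv_y (F * H) = 0" using FH by simp
    then show ?thesis by (simp add: Fy deriv_y_mult algebra_simps)
  qed
  \<comment> \<open>Writing 1 as \<open>F * H\<close> makes \<open>H\<close> a common factor, and
    \<open>F + e * (exp_x - 1)\<close> collapses to \<open>exp_x\<close>.\<close>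
  have "1 + deriv_y (bfps_log H) = F * H + e * (exp_x - 1) * H"
    unfolding deriv_y_bfps_log[OF FH H0] Hy FH ..
  also have "\<dots> = exp_x * H"
    by (simp add: F_def algebra_simps)
  finally have "fps_deriv (bfps_log H) = (e - 1) * (1 + deriv_y (bfps_log H))"
    unfolding Lx Hx by (simp add: mult_ac)
  then have pde: "fps_deriv (bfps_log H) =
      fps_const (fps_exp 1 - 1) * (1 + deriv_y (bfps_log H))"
    by (simp add: e_def flip: fps_const_sub)
  have "tree_series = bfps_log H"
  proof (rule fps_ext)
    fix n
    show "tree_series $ n = bfps_log H $ n"
    proof (cases n)
      case 0
      then show ?thesis using bfps_log_nth_0[OF H0] by (simp add: tree_series_def fps_eq_iff)
    next
      case (Suc m)
      then show ?thesis
        using pde_unique[OF bfps_log_nth_0[OF H0] pde] tree_series_nth_Suc by simp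
    qed
  qed
  then show ?thesis
    by (simp add: H_def F_def e_def bfps_exp_var_x bfps_exp_var_y bfps_exp_add)
qed

end
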